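(* Let $p$ be a prime and $k$ a positive integer, and let $C_{p^k}$ denote the cyclic group of order $p^k$. Then $$cq(C_{p^k})=mq(C_{p^k})=p^{2k}+p^{2k-2}-p^{k-1}-\sum_{i=k-1}^{2k-1}p^i.$$
   Context: For an abelian group $(G,+)$, automorphisms $\varphi,\psi$ of $(G,+)$ and $c\in G$, $\mathcal Q(G,+,\varphi,\psi,c)$ denotes the quasigroup $(G,* )$ with operation $x*y=\varphi(x)+\psi(y)+c$. Such quasigroups are called affine over $(G,+)$, or central quasigroups over $(G,+)$. A quasigroup $(Q,\cdot)$ is medial if $(x\cdot y)\cdot(u\cdot v)=(x\cdot u)\cdot(y\cdot v)$ for all $x,y,u,v\in Q$. For an abelian group $G$, $cq(G)$ denotes the number, up to isomorphism of quasigroups, of all quasigroups affine over $G$, and $mq(G)$ denotes the number, up to isomorphism, of all medial quasigroups affine over $G$ (equivalently, those $\mathcal Q(G,+,\varphi,\psi,c)$ with $\varphi\psi=\psi\varphi$). *)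

theory Defs
  imports
    "HOL-Algebra.Bij"
    "HOL-Algebra.Elementary_Groups"
    "HOL-Computational_Algebra.Primes"
begin

record 'a magma = "'a partial_object" +
  op :: "'a \<Rightarrow> 'a \<Rightarrow> 'a"

definition quasigroup :: "('a, 'm) magma_scheme \<Rightarrow> bool" where
  "quasigroup Q \<longleftrightarrow>
     (\<forall>x\<in>carrier Q. \<forall>y\<in>carrier Q. op Q x y \<in> carrier Q) \<and>
     (\<forall>a\<in>carrier Q. \<forall>b\<in>carrier Q. \<exists>!x. x \<in> carrier Q \<and> op Q a x = b) \<and>
     (\<forall>a\<in>carrier Q. \<forall>b\<in>carrier Q. \<exists>!y. y \<in> carrier Q \<and> op Q y a = b)"

definition medial_quasigroup :: "('a, 'm) magma_scheme \<Rightarrow> bool" where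
  "medial_quasigroup Q \<longleftrightarrow> quasigroup Q \<and>
     (\<forall>x\<in>carrier Q. \<forall>y\<in>carrier Q. \<forall>u\<in>carrier Q. \<forall>v\<in>carrier Q.
        op Q (op Q x y) (op Q u v) = op Q (op Q x u) (op Q y v))"

definition magma_iso :: "('a, 'm) magma_scheme \<Rightarrow> ('b, 'n) magma_scheme \<Rightarrow> ('a \<Rightarrow> 'b) set" where
  "magma_iso P Q = {h. bij_betw h (carrier P) (carrier Q) \<and>
     (\<forall>x\<in>carrier P. \<forall>y\<in>carrier P. h (op P x y) = op Q (h x) (h y))}"

definition magma_isomorphic :: "('a, 'm) magma_scheme \<Rightarrow> ('b, 'n) magma_scheme \<Rightarrow> bool" where
  "magma_isomorphic P Q \<longleftrightarrow> magma_iso P Q \<noteq> {}"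

(* Abelian groups are HOL-Algebra groups, hence written multiplicatively:
   phi(x) + psi(y) + c becomes \<phi> x \<otimes> \<psi> y \<otimes> c. *)
definition affine_magma ::
    "('a, 'g) monoid_scheme \<Rightarrow> ('a \<Rightarrow> 'a) \<Rightarrow> ('a \<Rightarrow> 'a) \<Rightarrow> 'a \<Rightarrow> 'a magma" where
  "affine_magma G \<phi> \<psi> c =
     \<lparr>carrier = carrier G, op = (\<lambda>x y. \<phi> x \<otimes>\<^bsub>G\<^esub> \<psi> y \<otimes>\<^bsub>G\<^esub> c)\<rparr>"

definition affine_quasigroups :: "('a, 'g) monoid_scheme \<Rightarrow> 'a magma set" where
  "affine_quasigroups G =
     {affine_magma G \<phi> \<psi> c | \<phi> \<psi> c. \<phi> \<in> auto G \<and> \<psi> \<in> auto G \<and> c \<in> carrier G}"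

(* The number of isomorphism classes in X. It is 0 if there are infinitely many classes,
   which cannot happen for the affine quasigroups over a finite group. *)
definition card_up_to_iso :: "'a magma set \<Rightarrow> nat" where
  "card_up_to_iso X = card (X // {(P, Q). P \<in> X \<and> Q \<in> X \<and> magma_isomorphic P Q})"

definition cq :: "('a, 'g) monoid_scheme \<Rightarrow> nat" where
  "cq G = card_up_to_iso (affine_quasigroups G)"

definition mq :: "('a, 'g) monoid_scheme \<Rightarrow> nat" where
  "mq G = card_up_to_iso {Q \<in> affine_quasigroups G. medial_quasigroup Q}"

lemma quasigroup_affine_magma:
  fixes G (structure)
  assumes "comm_group G" "\<phi> \<in> auto G" "\<psi> \<in> auto G" "c \<in> carrier G"
  shows "quasigroup (affine_magma G \<phi> \<psi> c)"
proof -
  interpret comm_group G by fact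
  have bij: "bij_betw \<phi> (carrier G) (carrier G)" "bij_betw \<psi> (carrier G) (carrier G)"
    using assms by (auto simp: auto_def Bij_def)
  then have cl: "\<And>x. x \<in> carrier G \<Longrightarrow> \<phi> x \<in> carrier G" "\<And>x. x \<in> carrier G \<Longrightarrow> \<psi> x \<in> carrier G"
    by (auto dest: bij_betwE)
  have ex: "\<exists>!x. x \<in> carrier G \<and> f x = b"
    if "bij_betw f (carrier G) (carrier G)" "b \<in> carrier G" for f b
  proof -
    have "b \<in> f ` carrier G" and inj: "inj_on f (carrier G)"
      using that by (simp_all add: bij_betw_def)
    then obtain a where "a \<in> carrier G" "b = f a" by (elim imageE)
    with inj show ?thesis by (intro ex1I[of _ a]) (auto dest: inj_onD)
  qed
  have solve: "u \<otimes> v \<otimes> c = b \<longleftrightarrow> v = inv u \<otimes> (b \<otimes> inv c)"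
    if "u \<in> carrier G" "v \<in> carrier G" "b \<in> carrier G" for u v b
  proof -
    have m: "u \<otimes> v \<in> carrier G" "b \<otimes> inv c \<in> carrier G"
      using that assms(4) by auto
    have "u \<otimes> v \<otimes> c = b \<longleftrightarrow> b \<otimes> inv c = u \<otimes> v"
      unfolding inv_solve_right'[OF m(1) that(3) assms(4)] by (rule eq_commute)
    also have "\<dots> \<longleftrightarrow> v = inv u \<otimes> (b \<otimes> inv c)"
      by (rule inv_solve_left[OF that(2,1) m(2), symmetric])
    finally show ?thesis .
  qed
  have l: "\<exists>!x. x \<in> carrier G \<and> \<phi> a \<otimes> \<psi> x \<otimes> c = b" if "a \<in> carrier G" "b \<in> carrier G" for a b
  proof -
    have "\<exists>!x. x \<in> carrier G \<and> \<psi> x = inv (\<phi> a) \<otimes> (b \<otimes> inv c)"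
      using that assms(4) cl by (intro ex[OF bij(2)]) auto
    moreover have "x \<in> carrier G \<and> \<phi> a \<otimes> \<psi> x \<otimes> c = b \<longleftrightarrow>
        x \<in> carrier G \<and> \<psi> x = inv (\<phi> a) \<otimes> (b \<otimes> inv c)" for x
      using solve[of "\<phi> a" "\<psi> x" b] that cl by blast
    ultimately show ?thesis by (simp only:)
  qed
  have r: "\<exists>!y. y \<in> carrier G \<and> \<phi> y \<otimes> \<psi> a \<otimes> c = b" if "a \<in> carrier G" "b \<in> carrier G" for a b
  proof -
    have "\<exists>!y. y \<in> carrier G \<and> \<phi> y = inv (\<psi> a) \<otimes> (b \<otimes> inv c)"
      using that assms(4) cl by (intro ex[OF bij(1)]) auto
    moreover have "y \<in> carrier G \<and> \<phi> y \<otimes> \<psi> a \<otimes> c = b \<longleftrightarrow>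
        y \<in> carrier G \<and> \<phi> y = inv (\<psi> a) \<otimes> (b \<otimes> inv c)" for y
      using solve[of "\<psi> a" "\<phi> y" b] m_comm[of "\<phi> y" "\<psi> a"] that cl by metis
    ultimately show ?thesis by (simp only:)
  qed
  show ?thesis
    using l r cl assms(4) by (auto simp: quasigroup_def affine_magma_def)
qed

end

theory Submission
  imports Defs "HOL-Number_Theory.Cong" "HOL-Algebra.Multiplicative_Group"
begin

text \<open>The automorphisms of a cyclic group of order \<open>p ^ k\<close> are the power maps with exponent prime to
\<open>p\<close>. They commute with one another, so every affine quasigroup over the group is medial and the two
numbers agree (\<open>mq_eq_cq\<close>).

Over an abelian group an isomorphism of affine quasigroups is an automorphism \<open>\<alpha>\<close> followed by a
translation by some \<open>t\<close>, where \<open>\<alpha>\<close> intertwines the two pairs of automorphisms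
(\<open>affine_magma_isomorphic_iff\<close>). When all automorphisms commute, intertwining means equality. So
the coefficients \<open>a\<close> and \<open>b\<close> of \<open>x * y = a x + b y + c\<close> on the integers modulo \<open>p ^ k\<close> are
isomorphism invariants, and only the constant can change: \<open>c\<close> becomes \<open>u c + (1 - a - b) t\<close> with a
unit \<open>u\<close> and an arbitrary \<open>t\<close>. The orbits of these changes are the orbits of the units on the
quotient by the ideal of \<open>1 - a - b\<close>, which is cyclic of \<open>p\<close>-power order. Each orbit contains
exactly one power \<open>p ^ j\<close> with \<open>j \<le> k\<close> that divides \<open>1 - a - b\<close>
(\<open>translation_constant_normal_form\<close> and \<open>translation_constant_normal_form_unique\<close>).

The isomorphism classes therefore correspond to the triples \<open>(a, b, j)\<close> with units \<open>a\<close>, \<open>b\<close> and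
\<open>a + b \<equiv> 1\<close> modulo \<open>p ^ j\<close>, which are counted by \<open>j\<close>. For \<open>j = 0\<close> all pairs of units qualify.
For \<open>j > 0\<close> the unit \<open>a\<close> must avoid the residue 1 modulo \<open>p\<close>, so that \<open>b \<equiv> 1 - a\<close> is a unit as
well, and then \<open>b\<close> has \<open>p ^ (k - j)\<close> possible values. A geometric sum gives the formula.\<close>

section \<open>Isomorphism classes and representatives\<close>

lemma card_quotient_transversal:
  assumes "equiv X R"
    and "\<And>t. t \<in> T \<Longrightarrow> F t \<in> X"
    and "\<And>x. x \<in> X \<Longrightarrow> \<exists>t\<in>T. (x, F t) \<in> R"
    and "\<And>s t. s \<in> T \<Longrightarrow> t \<in> T \<Longrightarrow> (F s, F t) \<in> R \<Longrightarrow> s = t"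
  shows "card (X // R) = card T"
proof -
  have "bij_betw (\<lambda>t. R `` {F t}) T (X // R)"
  proof (rule bij_betwI')
    show "(R `` {F s} = R `` {F t}) = (s = t)" if "s \<in> T" "t \<in> T" for s t
      using that assms(2,4) eq_equiv_class_iff[OF assms(1)] by blast
    show "R `` {F t} \<in> X // R" if "t \<in> T" for t
      using that assms(2) by (auto intro: quotientI)
    show "\<exists>t\<in>T. C = R `` {F t}" if C: "C \<in> X // R" for C
    proof -
      obtain x where x: "x \<in> X" "C = R `` {x}" using C by (auto elim: quotientE)
      with assms(3) show ?thesis using equiv_class_eq[OF assms(1)] by blast
    qed
  qed
  then show ?thesis by (simp add: bij_betw_same_card)
qed

lemma magma_isomorphic_refl: "magma_isomorphic P P"
proof -
  have "(\<lambda>x. x) \<in> magma_iso P P" by (auto simp: magma_iso_def bij_betw_def)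
  then show ?thesis by (auto simp: magma_isomorphic_def)
qed

text \<open>Closure of the domain makes the inverse map multiplicative: \<open>inv_into\<close> is a left inverse only on the
carrier, and it is applied to the image of a product.\<close>

lemma magma_isomorphic_sym:
  assumes "magma_isomorphic P Q"
    and closed: "\<And>x y. x \<in> carrier P \<Longrightarrow> y \<in> carrier P \<Longrightarrow> op P x y \<in> carrier P"
  shows "magma_isomorphic Q P"
proof -
  obtain h where h: "bij_betw h (carrier P) (carrier Q)"
    and hom: "\<And>x y. x \<in> carrier P \<Longrightarrow> y \<in> carrier P \<Longrightarrow> h (op P x y) = op Q (h x) (h y)"
    using assms(1) by (auto simp: magma_isomorphic_def magma_iso_def)
  let ?h' = "inv_into (carrier P) h"
  have h': "bij_betw ?h' (carrier Q) (carrier P)" by (rule bij_betw_inv_into[OF h])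
  have "?h' (op Q x y) = op P (?h' x) (?h' y)" if "x \<in> carrier Q" "y \<in> carrier Q" for x y
  proof -
    have m: "?h' x \<in> carrier P" "?h' y \<in> carrier P" using that h' by (auto dest: bij_betwE)
    then have "op Q x y = h (op P (?h' x) (?h' y))"
      using that h by (simp add: hom bij_betw_inv_into_right)
    then show ?thesis using closed[OF m] h by (simp add: bij_betw_inv_into_left)
  qed
  with h' show ?thesis by (auto simp: magma_isomorphic_def magma_iso_def)
qed

lemma magma_isomorphic_trans:
  assumes "magma_isomorphic P Q" "magma_isomorphic Q R"
  shows "magma_isomorphic P R"
proof -
  obtain h i where "h \<in> magma_iso P Q" "i \<in> magma_iso Q R"
    using assms by (auto simp: magma_isomorphic_def)
  then have "i \<circ> h \<in> magma_iso P R"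
    by (auto simp: magma_iso_def intro: bij_betw_trans dest: bij_betwE)
  then show ?thesis by (auto simp: magma_isomorphic_def)
qed

lemma equiv_magma_isomorphic:
  assumes "\<And>P. P \<in> X \<Longrightarrow> quasigroup P"
  shows "equiv X {(P, Q). P \<in> X \<and> Q \<in> X \<and> magma_isomorphic P Q}"
proof (rule equivI)
  show "sym {(P, Q). P \<in> X \<and> Q \<in> X \<and> magma_isomorphic P Q}"
    using assms by (auto intro!: symI magma_isomorphic_sym simp: quasigroup_def)
qed (auto intro!: refl_onI transI intro: magma_isomorphic_refl magma_isomorphic_trans)

section \<open>Isomorphisms between affine quasigroups\<close>

lemma (in group) autoD:
  assumes "\<alpha> \<in> auto G"
  shows "x \<in> carrier G \<Longrightarrow> \<alpha> x \<in> carrier G"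
    and "x \<in> carrier G \<Longrightarrow> y \<in> carrier G \<Longrightarrow> \<alpha> (x \<otimes> y) = \<alpha> x \<otimes> \<alpha> y"
    and "bij_betw \<alpha> (carrier G) (carrier G)"
    and "\<alpha> \<in> extensional (carrier G)"
    and "\<alpha> \<one> = \<one>"
  using assms
  by (auto simp: auto_def Bij_def hom_def Pi_iff intro!: hom_one[OF _ is_group is_group])

text \<open>From an isomorphism \<open>h\<close> one obtains \<open>t = h \<one>\<close> and \<open>\<alpha> x = h x \<otimes> inv t\<close>, so that \<open>\<alpha>\<close> fixes the
identity and satisfies the isomorphism equation with \<open>c'\<close> replaced by another constant \<open>e\<close>. Choosing
one argument so that its contribution cancels \<open>c\<close> shows that \<open>\<alpha>\<close> intertwines the automorphisms
acting on the other argument. This turns the isomorphism equation into additivity of \<open>\<alpha>\<close>, because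
\<open>\<phi>\<close> and \<open>\<psi>\<close> are onto.\<close>

lemma (in comm_group) affine_magma_isomorphic_iff:
  assumes \<phi>: "\<phi> \<in> auto G" and \<psi>: "\<psi> \<in> auto G" and c: "c \<in> carrier G"
    and \<phi>': "\<phi>' \<in> auto G" and \<psi>': "\<psi>' \<in> auto G" and c': "c' \<in> carrier G"
  shows "magma_isomorphic (affine_magma G \<phi> \<psi> c) (affine_magma G \<phi>' \<psi>' c') \<longleftrightarrow>
    (\<exists>\<alpha>\<in>auto G. \<exists>t\<in>carrier G.
       (\<forall>x\<in>carrier G. \<alpha> (\<phi> x) = \<phi>' (\<alpha> x)) \<and> (\<forall>x\<in>carrier G. \<alpha> (\<psi> x) = \<psi>' (\<alpha> x)) \<and>
       \<alpha> c \<otimes> t = \<phi>' t \<otimes> \<psi>' t \<otimes> c')"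
    (is "?iso \<longleftrightarrow> ?crit")
proof
  assume ?crit
  then obtain \<alpha> t where \<alpha>: "\<alpha> \<in> auto G" and t: "t \<in> carrier G"
    and com: "\<And>x. x \<in> carrier G \<Longrightarrow> \<alpha> (\<phi> x) = \<phi>' (\<alpha> x)"
      "\<And>x. x \<in> carrier G \<Longrightarrow> \<alpha> (\<psi> x) = \<psi>' (\<alpha> x)"
    and ct: "\<alpha> c \<otimes> t = \<phi>' t \<otimes> \<psi>' t \<otimes> c'"
    by blast
  note [simp] = autoD(1,2)[OF \<alpha>] autoD(1,2)[OF \<phi>] autoD(1,2)[OF \<psi>]
    autoD(1,2)[OF \<phi>'] autoD(1,2)[OF \<psi>'] c c' t
  let ?h = "\<lambda>x. \<alpha> x \<otimes> t"
  have "bij_betw (\<lambda>x. x \<otimes> t) (carrier G) (carrier G)"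
    by (rule bij_betwI[where g = "\<lambda>x. x \<otimes> inv t"]) (auto simp: m_assoc)
  then have bij: "bij_betw ?h (carrier G) (carrier G)"
    using bij_betw_trans[OF autoD(3)[OF \<alpha>]] by (simp add: o_def)
  have "?h (\<phi> x \<otimes> \<psi> y \<otimes> c) = \<phi>' (?h x) \<otimes> \<psi>' (?h y) \<otimes> c'"
    if x: "x \<in> carrier G" "y \<in> carrier G" for x y
  proof -
    have "?h (\<phi> x \<otimes> \<psi> y \<otimes> c) = \<phi>' (\<alpha> x) \<otimes> \<psi>' (\<alpha> y) \<otimes> (\<alpha> c \<otimes> t)"
      using x by (simp add: com m_assoc)
    also have "\<dots> = \<phi>' (\<alpha> x) \<otimes> \<psi>' (\<alpha> y) \<otimes> (\<phi>' t \<otimes> \<psi>' t \<otimes> c')"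
      by (simp only: ct)
    also have "\<dots> = \<phi>' (?h x) \<otimes> \<psi>' (?h y) \<otimes> c'"
      using x by (simp add: m_ac)
    finally show ?thesis .
  qed
  with bij have "?h \<in> magma_iso (affine_magma G \<phi> \<psi> c) (affine_magma G \<phi>' \<psi>' c')"
    by (auto simp: magma_iso_def affine_magma_def)
  then show ?iso by (auto simp: magma_isomorphic_def)
next
  assume ?iso
  then obtain h where bij: "bij_betw h (carrier G) (carrier G)"
    and h: "\<And>x y. x \<in> carrier G \<Longrightarrow> y \<in> carrier G \<Longrightarrow>
      h (\<phi> x \<otimes> \<psi> y \<otimes> c) = \<phi>' (h x) \<otimes> \<psi>' (h y) \<otimes> c'"
    by (auto simp: magma_isomorphic_def magma_iso_def affine_magma_def)
  have hG [simp]: "h x \<in> carrier G" if "x \<in> carrier G" for x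
    using bij that by (auto dest: bij_betwE)
  define t where "t = h \<one>"
  define \<alpha> where "\<alpha> = (\<lambda>x\<in>carrier G. h x \<otimes> inv t)"
  define e where "e = \<phi>' t \<otimes> \<psi>' t \<otimes> c' \<otimes> inv t"
  note \<phi>D = autoD[OF \<phi>] and \<psi>D = autoD[OF \<psi>]
  note [simp] = autoD(1,2,5)[OF \<phi>] autoD(1,2,5)[OF \<psi>]
    autoD(1,2,5)[OF \<phi>'] autoD(1,2,5)[OF \<psi>'] c c'
  have t [simp]: "t \<in> carrier G" by (simp add: t_def)
  have e [simp]: "e \<in> carrier G" by (simp add: e_def)
  have \<alpha>G [simp]: "\<alpha> x \<in> carrier G" if "x \<in> carrier G" for x
    using that by (simp add: \<alpha>_def)
  have \<alpha>1 [simp]: "\<alpha> \<one> = \<one>" by (simp add: \<alpha>_def t_def)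
  have h\<alpha>: "h x = \<alpha> x \<otimes> t" if "x \<in> carrier G" for x
    using that by (simp add: \<alpha>_def m_assoc)
  have \<alpha>aff: "\<alpha> (\<phi> x \<otimes> \<psi> y \<otimes> c) = \<phi>' (\<alpha> x) \<otimes> \<psi>' (\<alpha> y) \<otimes> e"
    if x: "x \<in> carrier G" "y \<in> carrier G" for x y
  proof -
    have "\<alpha> (\<phi> x \<otimes> \<psi> y \<otimes> c) = h (\<phi> x \<otimes> \<psi> y \<otimes> c) \<otimes> inv t"
      using x by (simp add: \<alpha>_def)
    also have "\<dots> = \<phi>' (\<alpha> x \<otimes> t) \<otimes> \<psi>' (\<alpha> y \<otimes> t) \<otimes> c' \<otimes> inv t"
      using h[OF x] h\<alpha>[OF x(1)] h\<alpha>[OF x(2)] by simp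
    also have "\<dots> = \<phi>' (\<alpha> x) \<otimes> \<psi>' (\<alpha> y) \<otimes> e"
      using x by (simp add: e_def m_ac)
    finally show ?thesis .
  qed
  have \<alpha>c: "\<alpha> c = e" using \<alpha>aff[of \<one> \<one>] by simp
  \<comment> \<open>The arguments whose contributions cancel the constant \<open>c\<close>.\<close>
  obtain x0 where x0 [simp]: "x0 \<in> carrier G" and \<phi>x0: "\<phi> x0 = inv c"
    using \<phi>D(3) by (metis c inv_closed bij_betw_imp_surj_on imageE)
  obtain y0 where y0 [simp]: "y0 \<in> carrier G" and \<psi>y0: "\<psi> y0 = inv c"
    using \<psi>D(3) by (metis c inv_closed bij_betw_imp_surj_on imageE)
  have com1: "\<alpha> (\<phi> x) = \<phi>' (\<alpha> x)" if x: "x \<in> carrier G" for x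
  proof -
    have *: "\<alpha> (\<phi> z) = \<phi>' (\<alpha> z) \<otimes> (\<psi>' (\<alpha> y0) \<otimes> e)" if "z \<in> carrier G" for z
      using \<alpha>aff[of z y0] that by (simp add: \<psi>y0 m_assoc)
    \<comment> \<open>The surplus factor does not depend on \<open>z\<close>, so the identity determines it.\<close>
    have "\<psi>' (\<alpha> y0) \<otimes> e = \<one>" using *[of \<one>] by simp
    then show ?thesis using *[OF x] x by simp
  qed
  have com2: "\<alpha> (\<psi> x) = \<psi>' (\<alpha> x)" if x: "x \<in> carrier G" for x
  proof -
    have *: "\<alpha> (\<psi> z) = \<psi>' (\<alpha> z) \<otimes> (\<phi>' (\<alpha> x0) \<otimes> e)" if "z \<in> carrier G" for z
    proof -
      have "\<phi> x0 \<otimes> \<psi> z \<otimes> c = \<psi> z"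
        using that by (simp add: \<phi>x0 m_comm[of "inv c" "\<psi> z"] m_assoc)
      then show ?thesis using \<alpha>aff[of x0 z] that by (simp add: m_ac)
    qed
    have "\<phi>' (\<alpha> x0) \<otimes> e = \<one>" using *[of \<one>] by simp
    then show ?thesis using *[OF x] x by simp
  qed
  have \<alpha>3: "\<alpha> (x \<otimes> y \<otimes> c) = \<alpha> x \<otimes> \<alpha> y \<otimes> \<alpha> c"
    if x: "x \<in> carrier G" "y \<in> carrier G" for x y
  proof -
    obtain u where u: "u \<in> carrier G" "x = \<phi> u"
      using \<phi>D(3) x(1) by (metis bij_betw_imp_surj_on imageE)
    obtain v where v: "v \<in> carrier G" "y = \<psi> v"
      using \<psi>D(3) x(2) by (metis bij_betw_imp_surj_on imageE)
    show ?thesis using u v \<alpha>aff[of u v] by (simp add: com1 com2 \<alpha>c)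
  qed
  have hom: "\<alpha> (x \<otimes> y) = \<alpha> x \<otimes> \<alpha> y" if x: "x \<in> carrier G" "y \<in> carrier G" for x y
  proof -
    have "\<alpha> (x \<otimes> y) \<otimes> \<alpha> c = \<alpha> x \<otimes> \<alpha> y \<otimes> \<alpha> c"
      using \<alpha>3[of "x \<otimes> y" \<one>] \<alpha>3[of x y] x by simp
    then show ?thesis using x by simp
  qed
  have "bij_betw (\<lambda>x. x \<otimes> inv t) (carrier G) (carrier G)"
    by (rule bij_betwI[where g = "\<lambda>x. x \<otimes> t"]) (auto simp: m_assoc)
  then have "bij_betw (\<lambda>x. h x \<otimes> inv t) (carrier G) (carrier G)"
    using bij_betw_trans[OF bij] by (simp add: o_def)
  then have "bij_betw \<alpha> (carrier G) (carrier G)"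
    by (simp add: \<alpha>_def cong: bij_betw_cong)
  then have "\<alpha> \<in> auto G"
    using hom by (auto simp: auto_def hom_def Bij_def \<alpha>_def)
  moreover have "\<alpha> c \<otimes> t = \<phi>' t \<otimes> \<psi>' t \<otimes> c'"
    by (simp add: \<alpha>c e_def m_assoc)
  ultimately show ?crit using com1 com2 t by blast
qed

text \<open>If the automorphisms commute, then \<open>\<alpha> \<circ> \<phi> = \<phi>' \<circ> \<alpha> = \<alpha> \<circ> \<phi>'\<close> on the carrier, and \<open>\<alpha>\<close> can be
cancelled. Equality as HOL functions follows because members of \<open>auto G\<close> are extensional.\<close>

lemma (in comm_group) affine_magma_isomorphic_iff_commuting:
  assumes com: "\<And>\<alpha> \<beta> x. \<alpha> \<in> auto G \<Longrightarrow> \<beta> \<in> auto G \<Longrightarrow> x \<in> carrier G \<Longrightarrow> \<alpha> (\<beta> x) = \<beta> (\<alpha> x)"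
    and \<phi>: "\<phi> \<in> auto G" and \<psi>: "\<psi> \<in> auto G" and c: "c \<in> carrier G"
    and \<phi>': "\<phi>' \<in> auto G" and \<psi>': "\<psi>' \<in> auto G" and c': "c' \<in> carrier G"
  shows "magma_isomorphic (affine_magma G \<phi> \<psi> c) (affine_magma G \<phi>' \<psi>' c') \<longleftrightarrow>
    \<phi> = \<phi>' \<and> \<psi> = \<psi>' \<and>
    (\<exists>\<alpha>\<in>auto G. \<exists>t\<in>carrier G. \<alpha> c \<otimes> t = \<phi> t \<otimes> \<psi> t \<otimes> c')"
proof -
  have eq: "(\<forall>x\<in>carrier G. \<alpha> (\<beta> x) = \<beta>' (\<alpha> x)) \<longleftrightarrow> \<beta> = \<beta>'"
    if "\<alpha> \<in> auto G" "\<beta> \<in> auto G" "\<beta>' \<in> auto G" for \<alpha> \<beta> \<beta>'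
  proof
    assume *: "\<forall>x\<in>carrier G. \<alpha> (\<beta> x) = \<beta>' (\<alpha> x)"
    have "\<beta> x = \<beta>' x" if x: "x \<in> carrier G" for x
    proof -
      have "\<alpha> (\<beta> x) = \<alpha> (\<beta>' x)"
        using * x com[OF \<open>\<alpha> \<in> auto G\<close> \<open>\<beta>' \<in> auto G\<close> x] by simp
      then show ?thesis
        using x autoD(1,3)[OF \<open>\<alpha> \<in> auto G\<close>] autoD(1)[OF \<open>\<beta> \<in> auto G\<close>] autoD(1)[OF \<open>\<beta>' \<in> auto G\<close>]
        by (auto simp: bij_betw_def dest: inj_onD)
    qed
    then show "\<beta> = \<beta>'"
      by (rule extensionalityI[OF autoD(4)[OF \<open>\<beta> \<in> auto G\<close>] autoD(4)[OF \<open>\<beta>' \<in> auto G\<close>]])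
  next
    assume "\<beta> = \<beta>'"
    then show "\<forall>x\<in>carrier G. \<alpha> (\<beta> x) = \<beta>' (\<alpha> x)" using com that by blast
  qed
  show ?thesis
    unfolding affine_magma_isomorphic_iff[OF \<phi> \<psi> c \<phi>' \<psi>' c']
    using eq[OF _ \<phi> \<phi>'] eq[OF _ \<psi> \<psi>'] by auto
qed

lemma (in comm_group) medial_affine_magma:
  assumes \<phi>: "\<phi> \<in> auto G" and \<psi>: "\<psi> \<in> auto G" and c: "c \<in> carrier G"
    and com: "\<And>x. x \<in> carrier G \<Longrightarrow> \<phi> (\<psi> x) = \<psi> (\<phi> x)"
  shows "medial_quasigroup (affine_magma G \<phi> \<psi> c)"
proof -
  note [simp] = autoD(1,2)[OF \<phi>] autoD(1,2)[OF \<psi>] c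
  have "\<phi> (\<phi> x \<otimes> \<psi> y \<otimes> c) \<otimes> \<psi> (\<phi> u \<otimes> \<psi> v \<otimes> c) \<otimes> c =
        \<phi> (\<phi> x \<otimes> \<psi> u \<otimes> c) \<otimes> \<psi> (\<phi> y \<otimes> \<psi> v \<otimes> c) \<otimes> c"
    if "x \<in> carrier G" "y \<in> carrier G" "u \<in> carrier G" "v \<in> carrier G" for x y u v
    using that by (simp add: com m_ac)
  moreover have "quasigroup (affine_magma G \<phi> \<psi> c)"
    by (rule quasigroup_affine_magma[OF comm_group_axioms \<phi> \<psi> c])
  ultimately show ?thesis by (simp add: medial_quasigroup_def affine_magma_def)
qed

section \<open>Automorphisms of a finite cyclic group\<close>

text \<open>The restriction to the carrier makes the map extensional, as membership in \<open>auto G\<close> requires.\<close>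

definition power_map :: "('a, 'b) monoid_scheme \<Rightarrow> nat \<Rightarrow> 'a \<Rightarrow> 'a" where
  "power_map G a = (\<lambda>x\<in>carrier G. x [^]\<^bsub>G\<^esub> a)"

locale finite_cyclic = comm_group G for G (structure) +
  fixes g
  assumes finite_carrier: "finite (carrier G)"
    and gen_closed [simp]: "g \<in> carrier G"
    and carrier_eq: "carrier G = range (\<lambda>i::int. g [^] i)"
begin

lemma ord_gen: "ord g = order G"
proof -
  have "generate G {g} = carrier G"
    unfolding generate_pow[OF gen_closed] carrier_eq by blast
  then show ?thesis using generate_pow_card[of g] by (simp add: order_def)
qed

lemma order_pos: "order G > 0"
  using finite_carrier by (simp add: order_gt_0_iff_finite)

lemma pow_gen_eq_iff: "g [^] (i::nat) = g [^] (j::nat) \<longleftrightarrow> [i = j] (mod order G)"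
proof -
  have "g [^] i = g [^] j \<longleftrightarrow> int (ord g) dvd int j - int i"
    using int_pow_eq[of g "int i" "int j"] by (simp add: int_pow_int)
  also have "\<dots> \<longleftrightarrow> [i = j] (mod order G)"
    by (simp add: ord_gen cong_iff_dvd_diff dvd_diff_commute flip: cong_int_iff)
  finally show ?thesis .
qed

lemma obtain_pow_gen:
  assumes "x \<in> carrier G"
  obtains i :: nat where "i < order G" "x = g [^] i"
proof -
  obtain i :: int where i: "x = g [^] i" using assms carrier_eq by auto
  let ?j = "nat (i mod int (order G))"
  have "int (ord g) dvd int ?j - i"
    using order_pos by (simp add: ord_gen) (metis dvd_minus_mod dvd_diff_commute)
  then have "x = g [^] ?j"
    using i int_pow_eq[of g i "int ?j"] by (simp add: int_pow_int)
  moreover have "?j < order G" using order_pos by (simp add: nat_less_iff)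
  ultimately show ?thesis using that by blast
qed

text \<open>An exponent prime to the order can be cancelled modulo the order, so the map is injective, and by
finiteness it is onto.\<close>

lemma power_map_in_auto:
  assumes "coprime a (order G)"
  shows "power_map G a \<in> auto G"
proof -
  have hom: "(\<lambda>x. x [^] a) \<in> hom G G" by (auto simp: hom_def pow_mult_distrib m_comm)
  have inj: "inj_on (\<lambda>x. x [^] a) (carrier G)"
  proof (rule inj_onI)
    fix x y assume x: "x \<in> carrier G" and y: "y \<in> carrier G" and xy: "x [^] a = y [^] a"
    obtain i j :: nat where ij: "x = g [^] i" "y = g [^] j"
      using obtain_pow_gen x y by metis
    have "[i * a = j * a] (mod order G)"
      using xy by (simp add: ij nat_pow_pow pow_gen_eq_iff)
    then show "x = y" using assms by (simp add: ij pow_gen_eq_iff cong_mult_rcancel_nat)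
  qed
  have "(\<lambda>x. x [^] a) ` carrier G = carrier G"
    by (rule endo_inj_surj[OF finite_carrier _ inj]) auto
  with inj hom show ?thesis
    by (auto simp: auto_def Bij_def bij_betw_def power_map_def hom_def inj_on_def)
qed

text \<open>An automorphism is determined by the exponent \<open>a\<close> of the image of the generator. A preimage \<open>g [^] i\<close>
of the generator gives \<open>a * i \<equiv> 1\<close>, so \<open>a\<close> is a unit.\<close>

lemma auto_eq_power_map:
  assumes "\<phi> \<in> auto G"
  obtains a where "a < order G" "coprime a (order G)" "\<phi> = power_map G a"
proof -
  note \<phi> = autoD[OF assms]
  obtain a where a: "a < order G" "\<phi> g = g [^] a"
    using obtain_pow_gen[OF \<phi>(1)[OF gen_closed]] by metis
  have pow: "\<phi> (g [^] (i::nat)) = g [^] (a * i)" for i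
    by (induction i) (simp_all add: \<phi> a nat_pow_mult add.commute)
  have "\<phi> x = power_map G a x" if x: "x \<in> carrier G" for x
  proof -
    obtain i :: nat where i: "x = g [^] i" using obtain_pow_gen[OF x] by metis
    show ?thesis by (simp add: i pow power_map_def nat_pow_pow mult.commute)
  qed
  then have "\<phi> = power_map G a"
    by (intro extensionalityI[OF \<phi>(4)]) (auto simp: power_map_def)
  moreover have "coprime a (order G)"
  proof -
    obtain x where x: "x \<in> carrier G" "\<phi> x = g"
      using \<phi>(3) by (metis gen_closed bij_betw_imp_surj_on imageE)
    obtain i :: nat where i: "x = g [^] i" using obtain_pow_gen[OF x(1)] by metis
    have "g [^] (a * i) = g [^] (1::nat)" using x(2) by (simp add: i pow)
    then have "[a * i = 1] (mod order G)" by (simp only: pow_gen_eq_iff)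
    then show ?thesis using coprime_iff_invertible_nat by auto
  qed
  ultimately show ?thesis using a(1) that by blast
qed

lemma power_map_eq_iff:
  assumes "a < order G" "b < order G"
  shows "power_map G a = power_map G b \<longleftrightarrow> a = b"
proof
  assume "power_map G a = power_map G b"
  then have "power_map G a g = power_map G b g" by simp
  then have "[a = b] (mod order G)" by (simp add: power_map_def pow_gen_eq_iff)
  then show "a = b" using assms by (rule cong_less_modulus_unique_nat)
qed simp

lemma auto_commute:
  assumes "\<alpha> \<in> auto G" "\<beta> \<in> auto G" "x \<in> carrier G"
  shows "\<alpha> (\<beta> x) = \<beta> (\<alpha> x)"
proof -
  obtain a b where "\<alpha> = power_map G a" "\<beta> = power_map G b"
    using auto_eq_power_map assms(1,2) by metis
  then show ?thesis using assms(3) by (simp add: power_map_def nat_pow_pow mult.commute)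
qed

text \<open>The isomorphism criterion read on exponents of the generator: \<open>u\<close> is the exponent of the automorphism
\<open>\<alpha>\<close> and \<open>t\<close> that of the translation. Keeping \<open>t\<close> on both sides avoids the subtraction in
\<open>u * i = i' - (1 - a - b) * t\<close>.\<close>

lemma affine_magma_power_isomorphic_iff:
  assumes a: "a < order G" "coprime a (order G)" and b: "b < order G" "coprime b (order G)"
    and a': "a' < order G" "coprime a' (order G)" and b': "b' < order G" "coprime b' (order G)"
  shows "magma_isomorphic (affine_magma G (power_map G a) (power_map G b) (g [^] (i::nat)))
            (affine_magma G (power_map G a') (power_map G b') (g [^] (i'::nat))) \<longleftrightarrow>
    a = a' \<and> b = b' \<and>
    (\<exists>u t. coprime u (order G) \<and> [u * i + t = (a + b) * t + i'] (mod order G))"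
    (is "?iso \<longleftrightarrow> _")
proof -
  have "(\<exists>\<alpha>\<in>auto G. \<exists>t\<in>carrier G.
           \<alpha> (g [^] i) \<otimes> t = power_map G a t \<otimes> power_map G b t \<otimes> g [^] i') \<longleftrightarrow>
        (\<exists>u t. coprime u (order G) \<and> [u * i + t = (a + b) * t + i'] (mod order G))"
    (is "?L \<longleftrightarrow> ?R")
  proof -
    have *: "power_map G u (g [^] i) \<otimes> g [^] t =
        power_map G a (g [^] t) \<otimes> power_map G b (g [^] t) \<otimes> g [^] i' \<longleftrightarrow>
        [u * i + t = (a + b) * t + i'] (mod order G)" for u t :: nat
      by (simp add: power_map_def nat_pow_pow nat_pow_mult pow_gen_eq_iff algebra_simps)
    show ?thesis
    proof
      assume ?L
      then obtain \<alpha> x where \<alpha>: "\<alpha> \<in> auto G" and x: "x \<in> carrier G" and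
        eq: "\<alpha> (g [^] i) \<otimes> x = power_map G a x \<otimes> power_map G b x \<otimes> g [^] i'" by blast
      obtain u where u: "coprime u (order G)" "\<alpha> = power_map G u"
        using auto_eq_power_map[OF \<alpha>] by metis
      obtain t :: nat where t: "x = g [^] t" using obtain_pow_gen[OF x] by metis
      show ?R using eq *[of u t] u t by auto
    next
      assume ?R
      then obtain u t where u: "coprime u (order G)"
        and ut: "[u * i + t = (a + b) * t + i'] (mod order G)" by blast
      show ?L
        by (rule bexI[OF _ power_map_in_auto[OF u]], rule bexI[of _ "g [^] t"])
          (use ut * in auto)
    qed
  qed
  moreover have "?iso \<longleftrightarrow> power_map G a = power_map G a' \<and> power_map G b = power_map G b' \<and>
    (\<exists>\<alpha>\<in>auto G. \<exists>t\<in>carrier G.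
      \<alpha> (g [^] i) \<otimes> t = power_map G a t \<otimes> power_map G b t \<otimes> g [^] i')"
    using assms by (intro affine_magma_isomorphic_iff_commuting auto_commute power_map_in_auto) auto
  ultimately show ?thesis using assms by (simp add: power_map_eq_iff)
qed

end

section \<open>Orbits of translation constants modulo a prime power\<close>

text \<open>Here \<open>s\<close> stands for \<open>a + b\<close>. Let \<open>p ^ m\<close> be the greatest common divisor of \<open>1 - s\<close> and \<open>p ^ k\<close>.
The exponent reached is that of the greatest common divisor of \<open>i\<close>, \<open>1 - s\<close> and \<open>p ^ k\<close>. If \<open>p ^ m\<close>
divides \<open>i\<close>, a translation alone carries \<open>i\<close> to \<open>p ^ m\<close>, since the multiples of \<open>1 - s\<close> modulo
\<open>p ^ k\<close> are those of \<open>p ^ m\<close>. Otherwise \<open>i\<close> is a unit times a power \<open>p ^ j\<close> with \<open>j < m\<close>, and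
dividing by that unit suffices.\<close>

lemma translation_constant_normal_form:
  fixes p :: nat
  assumes p: "prime p"
  obtains u t j where "coprime u p" "j \<le> k" "[s = 1] (mod p ^ j)"
    "[u * i + t = s * t + p ^ j] (mod p ^ k)"
proof -
  have p0: "p > 0" using p by (simp add: prime_gt_0_nat)
  define d where "d = 1 - int s"
  obtain m where m: "m \<le> k" "nat (gcd d (int (p ^ k))) = p ^ m"
  proof -
    have "nat (gcd d (int (p ^ k))) dvd p ^ k" by (simp add: nat_dvd_iff)
    then show ?thesis using that divides_primepow_nat[OF p] by blast
  qed
  then have e: "gcd d (int (p ^ k)) = int (p ^ m)" by (metis gcd_ge_0_int nat_eq_iff2)
  then have "int (p ^ m) dvd int s - 1" by (metis d_def dvd_diff_commute gcd_dvd1)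
  then have sm: "[s = 1] (mod p ^ m)"
    by (metis cong_iff_dvd_diff cong_int_iff of_nat_1)
  show ?thesis
  proof (cases "p ^ m dvd i")
    case True
    then have "gcd d (int (p ^ k)) dvd int (p ^ m) - int i"
      unfolding e by (intro dvd_diff) (auto simp only: of_nat_dvd_iff dvd_refl)
    then obtain x where x: "[d * x = int (p ^ m) - int i] (mod int (p ^ k))"
      using cong_solve_dvd_int by blast
    define t where "t = nat (x mod int (p ^ k))"
    have "int t = x mod int (p ^ k)" using p0 by (simp add: t_def)
    then have "[d * int t = d * x] (mod int (p ^ k))"
      by (simp add: cong_def mod_mult_right_eq)
    then have "[d * int t = int (p ^ m) - int i] (mod int (p ^ k))" using x by (rule cong_trans)
    then have "[d * int t + (int i + int s * int t) = int (p ^ m) - int i + (int i + int s * int t)]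
      (mod int (p ^ k))" by (rule cong_add) simp
    then have "[int (1 * i + t) = int (s * t + p ^ m)] (mod int (p ^ k))"
      by (simp add: d_def algebra_simps)
    then have "[1 * i + t = s * t + p ^ m] (mod p ^ k)" by (simp only: cong_int_iff)
    then show ?thesis using that[of 1 m t] m(1) sm by simp
  next
    case False
    obtain j where j: "j \<le> k" "gcd i (p ^ k) = p ^ j"
      using divides_primepow_nat[OF p] by (metis gcd_dvd2)
    have jm: "j < m"
    proof (rule ccontr)
      assume "\<not> j < m"
      then have "p ^ m dvd p ^ j" by (simp add: le_imp_power_dvd)
      then show False using False j(2) by (metis dvd_trans gcd_dvd1)
    qed
    obtain w where w: "i = p ^ j * w" using j(2) by (metis dvdE gcd_dvd1)
    have "\<not> p dvd w"
    proof
      assume "p dvd w"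
      then have "p ^ Suc j dvd i" by (simp add: w mult.commute[of p])
      moreover have "p ^ Suc j dvd p ^ k" using jm m(1) by (intro le_imp_power_dvd) simp
      ultimately have "p ^ Suc j dvd p ^ j" using j(2) by (metis gcd_greatest)
      then show False using power_dvd_imp_le[OF _ prime_gt_1_nat[OF p]] by fastforce
    qed
    then have "coprime w (p ^ k)"
      using p by (simp add: prime_imp_coprime coprime_commute[of w])
    then obtain u where u: "[w * u = 1] (mod p ^ k)" by (metis cong_solve_coprime_nat One_nat_def)
    then have "coprime u (p ^ k)" using coprime_iff_invertible_nat by (metis mult.commute One_nat_def)
    then have "coprime u p" using jm m(1) by simp
    moreover have "[u * i + 0 = s * 0 + p ^ j] (mod p ^ k)"
      using cong_scalar_left[OF u, of "p ^ j"] by (simp add: w ac_simps)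
    moreover have "[s = 1] (mod p ^ j)"
      using sm jm by (meson cong_dvd_modulus_nat le_imp_power_dvd less_imp_le)
    ultimately show ?thesis using that j(1) by blast
  qed
qed

text \<open>Modulo any power \<open>p ^ l\<close> with \<open>l \<le> k\<close> dividing \<open>1 - s\<close> the translation has no effect, which leaves
\<open>u * p ^ j \<equiv> p ^ j'\<close>. The choices \<open>l = j\<close> and \<open>l = j'\<close> give divisibility in both directions.\<close>

lemma translation_constant_normal_form_unique:
  fixes p :: nat
  assumes p: "prime p" and u: "coprime u p" and j: "j \<le> k" "j' \<le> k"
    and s: "[s = 1] (mod p ^ j)" "[s = 1] (mod p ^ j')"
    and eq: "[u * p ^ j + t = s * t + p ^ j'] (mod p ^ k)"
  shows "j = j'"
proof (rule antisym)
  have p1: "p > 1" using p by (rule prime_gt_1_nat)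
  have red: "[u * p ^ j = p ^ j'] (mod p ^ l)" if "l \<le> k" "[s = 1] (mod p ^ l)" for l
  proof -
    have "[u * p ^ j + t = s * t + p ^ j'] (mod p ^ l)"
      using eq that(1) by (meson cong_dvd_modulus_nat le_imp_power_dvd)
    also have "[s * t + p ^ j' = 1 * t + p ^ j'] (mod p ^ l)"
      using that(2) by (intro cong_add cong_mult) simp_all
    finally show ?thesis
      by (metis add.commute cong_add_rcancel_nat mult_1)
  qed
  have "p ^ j dvd p ^ j'"
    using red[OF j(1) s(1)] by (metis cong_dvd_iff dvd_triv_right)
  then show "j \<le> j'" using p1 power_dvd_imp_le by blast
  have "p ^ j' dvd u * p ^ j"
    using red[OF j(2) s(2)] by (metis cong_dvd_iff dvd_refl)
  then have "p ^ j' dvd p ^ j"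
    using u by (simp add: coprime_commute coprime_dvd_mult_right_iff)
  then show "j' \<le> j" using p1 power_dvd_imp_le by blast
qed

section \<open>Counting the normal forms\<close>

lemma card_residues_in:
  fixes m q :: nat
  assumes S: "S \<subseteq> {..<m}"
  shows "card {x. x < q * m \<and> x mod m \<in> S} = q * card S"
proof -
  have "bij_betw (\<lambda>(i, r). i * m + r) ({..<q} \<times> S) {x. x < q * m \<and> x mod m \<in> S}"
  proof (rule bij_betwI[where g = "\<lambda>x. (x div m, x mod m)"])
    show "(\<lambda>(i, r). i * m + r) \<in> {..<q} \<times> S \<rightarrow> {x. x < q * m \<and> x mod m \<in> S}"
    proof safe
      fix i r assume i: "i < q" and r: "r \<in> S"
      have "i * m + r < Suc i * m" using r S by auto
      also have "\<dots> \<le> q * m" using i by (intro mult_right_mono) auto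
      finally show "i * m + r < q * m" .
      show "(i * m + r) mod m \<in> S" using r S by auto
    qed
    show "(\<lambda>x. (x div m, x mod m)) \<in> {x. x < q * m \<and> x mod m \<in> S} \<rightarrow> {..<q} \<times> S"
      by (auto simp: less_mult_imp_div_less)
  qed (use S in \<open>auto simp: subset_iff\<close>)
  then have "card ({..<q} \<times> S) = card {x. x < q * m \<and> x mod m \<in> S}" by (rule bij_betw_same_card)
  then show ?thesis by (simp add: card_cartesian_product)
qed

lemma card_solutions_add_cong:
  fixes a c m q :: nat
  assumes "m > 0"
  shows "card {b. b < q * m \<and> [a + b = c] (mod m)} = q"
proof -
  define r where "r = nat ((int c - int a) mod int m)"
  have r: "int r = (int c - int a) mod int m" "r < m"
    using assms by (simp_all add: r_def nat_less_iff)
  have "[a + b = c] (mod m) \<longleftrightarrow> b mod m \<in> {r}" for b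
  proof -
    have "[a + b = c] (mod m) \<longleftrightarrow> [int b = int c - int a] (mod int m)"
      by (simp add: cong_iff_dvd_diff algebra_simps flip: cong_int_iff)
    also have "\<dots> \<longleftrightarrow> int (b mod m) = int r" by (simp add: cong_def r zmod_int)
    finally show ?thesis by simp
  qed
  then show ?thesis using card_residues_in[of "{r}" m q] r by simp
qed

text \<open>The triple \<open>(a, b, j)\<close> encodes the quasigroup \<open>x * y = a x + b y + p ^ j\<close> on the integers modulo
\<open>p ^ k\<close>. For \<open>j = k\<close> the constant is zero. The congruence says that \<open>p ^ j\<close> divides \<open>1 - a - b\<close>.\<close>

definition normal_forms :: "nat \<Rightarrow> nat \<Rightarrow> (nat \<times> nat \<times> nat) set" where
  "normal_forms p k = {(a, b, j). a < p ^ k \<and> coprime a p \<and> b < p ^ k \<and> coprime b p \<and>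
     j \<le> k \<and> [a + b = 1] (mod p ^ j)}"

lemma card_units_prime_power:
  fixes p :: nat
  assumes "prime p"
  shows "card {a. a < p ^ Suc m \<and> coprime a p} = p ^ m * (p - 1)"
proof -
  have "coprime a p \<longleftrightarrow> a mod p \<in> {1..<p}" for a
  proof -
    have "coprime a p \<longleftrightarrow> \<not> p dvd a"
      using assms by (metis coprime_commute prime_imp_coprime coprime_absorb_left not_prime_unit)
    then show ?thesis
      using prime_gt_0_nat[OF assms] by (auto simp: dvd_eq_mod_eq_0 Suc_le_eq)
  qed
  then show ?thesis
    using card_residues_in[of "{1..<p}" p "p ^ m"] by (simp add: mult.commute subset_iff)
qed

text \<open>Since \<open>j > 0\<close>, the congruence also holds modulo \<open>p\<close>, where it makes \<open>b\<close> a unit exactly if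
\<open>a \<noteq> 1\<close>. This leaves \<open>p - 2\<close> residues for \<open>a\<close>, and none if \<open>p = 2\<close>. Each admissible \<open>a\<close> then
determines \<open>b\<close> modulo \<open>p ^ j\<close>.\<close>

lemma card_unit_pairs_add_cong_1:
  fixes p :: nat
  assumes p: "prime p" and j: "0 < j" "j \<le> Suc m"
  shows "card {(a, b). a < p ^ Suc m \<and> coprime a p \<and> b < p ^ Suc m \<and> coprime b p \<and>
           [a + b = 1] (mod p ^ j)} = p ^ m * (p - 2) * p ^ (Suc m - j)"
proof -
  have p1: "p > 1" using p by (rule prime_gt_1_nat)
  have cop: "coprime a p \<longleftrightarrow> \<not> [a = 0] (mod p)" for a
    using p by (metis cong_0_iff coprime_commute prime_imp_coprime coprime_absorb_left not_prime_unit)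
  have pair: "coprime a p \<and> coprime b p \<longleftrightarrow> a mod p \<in> {2..<p}"
    if ab: "[a + b = 1] (mod p ^ j)" for a b
  proof -
    have ab': "[a + b = 1] (mod p)" using ab j(1) by (metis cong_dvd_modulus_nat dvd_power)
    have "[b = 0] (mod p) \<longleftrightarrow> [a = 1] (mod p)"
    proof
      assume "[b = 0] (mod p)"
      then have "[a + b = a + 0] (mod p)" by (rule cong_add[OF cong_refl])
      then show "[a = 1] (mod p)" using ab' by (metis add_0_right cong_sym cong_trans)
    next
      assume "[a = 1] (mod p)"
      then have "[a + b = a + 0] (mod p)" using ab' by (metis add_0_right cong_sym cong_trans)
      then show "[b = 0] (mod p)" by (simp only: cong_add_lcancel_nat)
    qed
    moreover have "a mod p < p" using p1 by simp
    ultimately show ?thesis using p1 by (auto simp: cop cong_def)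
  qed
  have "{(a, b). a < p ^ Suc m \<and> coprime a p \<and> b < p ^ Suc m \<and> coprime b p \<and>
           [a + b = 1] (mod p ^ j)} =
        (SIGMA a:{a. a < p ^ m * p \<and> a mod p \<in> {2..<p}}.
           {b. b < p ^ (Suc m - j) * p ^ j \<and> [a + b = 1] (mod p ^ j)})"
    using pair j(2) by (auto simp: mult.commute[of p] simp flip: power_add)
  then show ?thesis
    using p1 card_residues_in[of "{2..<p}" p "p ^ m"]
    by (simp add: card_solutions_add_cong card_SigmaI subset_iff)
qed

lemma card_normal_forms:
  assumes p: "prime p" and k: "k > 0"
  shows "int (card (normal_forms p k)) =
    int p ^ (2 * k) + int p ^ (2 * k - 2) - int p ^ (k - 1) - (\<Sum>i = k - 1..2 * k - 1. int p ^ i)"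
proof -
  obtain m where m: "k = Suc m" using k by (cases k) auto
  let ?U = "{a. a < p ^ k \<and> coprime a p}"
  let ?N = "\<lambda>j. {(a, b). a < p ^ k \<and> coprime a p \<and> b < p ^ k \<and> coprime b p \<and>
                [a + b = 1] (mod p ^ j)}"
  have p1: "p \<ge> 2" using p by (simp add: prime_ge_2_nat)
  have fin: "finite (?N j)" for j
    by (rule finite_subset[of _ "{..<p ^ k} \<times> {..<p ^ k}"]) auto
  have "bij_betw (\<lambda>(j, a, b). (a, b, j)) (SIGMA j:{..k}. ?N j) (normal_forms p k)"
    by (rule bij_betwI[where g = "\<lambda>(a, b, j). (j, a, b)"]) (auto simp: normal_forms_def)
  then have "card (normal_forms p k) = (\<Sum>j\<le>k. card (?N j))"
    using fin by (simp add: card_SigmaI flip: bij_betw_same_card)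
  also have "\<dots> = card (?N 0) + (\<Sum>j=1..k. card (?N j))"
    by (simp add: atMost_atLeast0 sum.atLeast_Suc_atMost)
  also have "?N 0 = ?U \<times> ?U" by auto
  also have "card \<dots> = (p ^ m * (p - 1)) ^ 2"
    using card_units_prime_power[OF p, of m]
    by (simp add: m card_cartesian_product power2_eq_square)
  also have "(\<Sum>j=1..k. card (?N j)) = (\<Sum>j=1..k. p ^ m * (p - 2) * p ^ (k - j))"
    using card_unit_pairs_add_cong_1[OF p, of _ m] by (intro sum.cong) (auto simp: m)
  also have "\<dots> = p ^ m * (p - 2) * (\<Sum>i<k. p ^ i)"
    unfolding sum_distrib_left
    by (rule sum.reindex_bij_witness[of _ "\<lambda>i. k - i" "\<lambda>j. k - j"]) auto
  finally have card: "int (card (normal_forms p k)) =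
      (int p ^ m * (int p - 1)) ^ 2 + int p ^ m * ((int p - 2) * (\<Sum>i<k. int p ^ i))"
    using p1 by (simp add: of_nat_diff)
  define S where "S = (\<Sum>i<k. int p ^ i)"
  \<comment> \<open>The form of \<open>(p - 1) * S = p ^ k - 1\<close> that removes the product \<open>p * S\<close>.\<close>
  have geo: "(int p - 2) * S = int p * int p ^ m - 1 - S"
  proof -
    have "(int p - 1) * S = int p ^ k - 1" unfolding S_def by (rule power_diff_1_eq[symmetric])
    then show ?thesis by (simp add: m algebra_simps)
  qed
  have "(\<Sum>i = k - 1..2 * k - 1. int p ^ i) = (\<Sum>i\<le>k. int p ^ m * int p ^ i)"
    by (rule sum.reindex_bij_witness[of _ "\<lambda>i. i + m" "\<lambda>i. i - m"])
      (auto simp: m simp flip: power_add)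
  also have "\<dots> = int p ^ m * (S + int p * int p ^ m)"
    by (simp add: m S_def lessThan_Suc_atMost[symmetric] flip: sum_distrib_left)
  finally have sum: "(\<Sum>i = k - 1..2 * k - 1. int p ^ i) = int p ^ m * (S + int p * int p ^ m)" .
  have pw: "int p ^ (2 * k) = (int p * int p ^ m)\<^sup>2" "int p ^ (2 * k - 2) = (int p ^ m)\<^sup>2"
    by (simp_all add: m power_mult_distrib power_mult mult.commute[of 2] power2_eq_square)
  show ?thesis
    unfolding card sum pw S_def[symmetric] geo
    by (simp add: m power2_eq_square algebra_simps)
qed

section \<open>The number of affine quasigroups over a cyclic group of prime power order\<close>

text \<open>The normal forms represent every isomorphism class exactly once: the isomorphism criterion recovers
\<open>a\<close> and \<open>b\<close>, and the orbit of the constant recovers \<open>j\<close>.\<close>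

lemma (in finite_cyclic) cq_eq_card_normal_forms:
  assumes p: "prime p" and k: "k > 0" and ord: "order G = p ^ k"
  shows "cq G = card (normal_forms p k)"
  unfolding cq_def card_up_to_iso_def
proof (rule card_quotient_transversal)
  let ?F = "\<lambda>(a, b, j). affine_magma G (power_map G a) (power_map G b) (g [^] (p ^ j))"
  let ?X = "affine_quasigroups G"
  let ?R = "{(P, Q). P \<in> ?X \<and> Q \<in> ?X \<and> magma_isomorphic P Q}"
  have cop: "coprime a (order G) \<longleftrightarrow> coprime a p" for a using k by (simp add: ord)
  show "equiv ?X ?R"
    by (rule equiv_magma_isomorphic)
      (auto simp: affine_quasigroups_def intro: quasigroup_affine_magma[OF comm_group_axioms])
  show F: "?F t \<in> ?X" if "t \<in> normal_forms p k" for t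
    using that power_map_in_auto by (fastforce simp: normal_forms_def affine_quasigroups_def cop)
  show "\<exists>t\<in>normal_forms p k. (Q, ?F t) \<in> ?R" if Q: "Q \<in> ?X" for Q
  proof -
    obtain \<phi> \<psi> c where \<phi>: "\<phi> \<in> auto G" and \<psi>: "\<psi> \<in> auto G" and c: "c \<in> carrier G"
      and Q_eq: "Q = affine_magma G \<phi> \<psi> c"
      using Q by (auto simp: affine_quasigroups_def)
    obtain a where a: "a < order G" "coprime a (order G)" "\<phi> = power_map G a"
      using auto_eq_power_map[OF \<phi>] by metis
    obtain b where b: "b < order G" "coprime b (order G)" "\<psi> = power_map G b"
      using auto_eq_power_map[OF \<psi>] by metis
    obtain i :: nat where i: "c = g [^] i" using obtain_pow_gen[OF c] by metis
    obtain u t j where nf: "coprime u p" "j \<le> k" "[a + b = 1] (mod p ^ j)"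
      "[u * i + t = (a + b) * t + p ^ j] (mod p ^ k)"
      using translation_constant_normal_form[OF p] by metis
    have T: "(a, b, j) \<in> normal_forms p k"
      using a b nf by (simp add: normal_forms_def cop) (simp add: ord)
    have "magma_isomorphic Q (?F (a, b, j))"
      using nf(1,4) a b
      by (auto simp: Q_eq i affine_magma_power_isomorphic_iff cop) (auto simp: ord)
    then show ?thesis using T Q F[OF T] by blast
  qed
  show "s = t" if s: "s \<in> normal_forms p k" and t: "t \<in> normal_forms p k" and R: "(?F s, ?F t) \<in> ?R"
    for s t
  proof -
    obtain a b j a' b' j' where st: "s = (a, b, j)" "t = (a', b', j')"
      by (metis prod_cases3)
    have iso: "magma_isomorphic (?F s) (?F t)" using R by simp
    have "a = a' \<and> b = b' \<and>
      (\<exists>u t. coprime u (order G) \<and> [u * p ^ j + t = (a + b) * t + p ^ j'] (mod order G))"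
      using s t iso
      by (subst affine_magma_power_isomorphic_iff[symmetric])
        (auto simp: st normal_forms_def cop, auto simp: ord)
    then obtain u r where "a = a'" "b = b'" "coprime u p"
      "[u * p ^ j + r = (a + b) * r + p ^ j'] (mod p ^ k)"
      by (auto simp: cop) (auto simp: ord)
    moreover from this have "j = j'"
      using s t by (intro translation_constant_normal_form_unique[OF p]) (auto simp: st normal_forms_def)
    ultimately show ?thesis by (simp add: st)
  qed
qed

lemma (in finite_cyclic) mq_eq_cq: "mq G = cq G"
proof -
  have "{Q \<in> affine_quasigroups G. medial_quasigroup Q} = affine_quasigroups G"
    by (auto simp: affine_quasigroups_def intro: medial_affine_magma auto_commute)
  then show ?thesis by (simp add: mq_def cq_def)
qed

theorem theorem3p1:
  fixes G :: "'a monoid" and p k :: nat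
  assumes "prime p" and "k > 0"
    and "group G" and "cyclic_group G" and "order G = p ^ k"
  shows "cq G = mq G \<and>
         int (mq G) = int p ^ (2 * k) + int p ^ (2 * k - 2) - int p ^ (k - 1)
                        - (\<Sum>i = k - 1..2 * k - 1. int p ^ i)"
proof -
  interpret group G by fact
  interpret comm_group G using assms(4) by (rule cyclic_imp_abelian_group)
  obtain g where g: "g \<in> carrier G" "carrier G = range (\<lambda>i::int. g [^]\<^bsub>G\<^esub> i)"
    using assms(4) cyclic_group by blast
  have "order G > 0" using assms(1,5) by (simp add: prime_gt_0_nat)
  then have "finite (carrier G)" by (simp add: order_gt_0_iff_finite)
  with g interpret finite_cyclic G g by unfold_locales auto
  show ?thesis
    using cq_eq_card_normal_forms[OF assms(1,2,5)] mq_eq_cq card_normal_forms[OF assms(1,2)] by simp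
qed

end
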